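(* Let $A,a$ be positive integers. For every non-negative integer $n$, $$p_{A,a}(n)=p(n)+\sum_{m\geq 1}\left[p\!\left(n-\Big(A\binom{2m}{2}+2am\Big)\right)-p\!\left(n-\Big(A\binom{2m-1}{2}+a(2m-1)\Big)\right)\right].$$
   Context: A partition of a non-negative integer $n$ is a finite multiset of positive integers summing to $n$; $p(n)$ is the number of partitions of $n$, with $p(0)=1$ and $p(k)=0$ for $k<0$. For positive integers $A,a$ and a partition $\pi$, $\mathrm{mex}_{A,a}(\pi)$ is the smallest element of $\{a,a+A,a+2A,\dots\}$ that is not a part of $\pi$. $p_{A,a}(n)$ is the number of partitions $\pi$ of $n$ with $\mathrm{mex}_{A,a}(\pi)\equiv a \pmod{2A}$. *)

theory Defs
  imports "HOL-Library.Multiset" "HOL-Number_Theory.Cong" "HOL-Analysis.Infinite_Sum"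
begin

definition partitions :: "nat \<Rightarrow> nat multiset set" where
  "partitions n = {\<pi>. (\<forall>x \<in># \<pi>. x > 0) \<and> sum_mset \<pi> = n}"

definition num_partitions :: "int \<Rightarrow> int" where
  "num_partitions k = (if k < 0 then 0 else int (card (partitions (nat k))))"

definition mex :: "nat \<Rightarrow> nat \<Rightarrow> nat multiset \<Rightarrow> nat" where
  "mex A a \<pi> = (LEAST x. x \<in> {a + k * A |k. True} \<and> x \<notin># \<pi>)"

definition num_mex_partitions :: "nat \<Rightarrow> nat \<Rightarrow> nat \<Rightarrow> nat" where
  "num_mex_partitions A a n = card {\<pi> \<in> partitions n. [mex A a \<pi> = a] (mod 2 * A)}"

text \<open>The lemmas below rule out degenerate readings: the cardinalities are of finite sets,
  the minimum in \<^const>\<open>mex\<close> exists, and the sum over all \<open>m \<ge> 1\<close> of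
  partition-number differences has only finitely many nonzero terms.\<close>

lemma size_le_sum_mset:
  assumes "\<forall>x \<in># \<pi>. x > (0::nat)"
  shows "size \<pi> \<le> sum_mset \<pi>"
  using assms by (induction \<pi>) auto

lemma finite_partitions: "finite (partitions n)"
proof (rule finite_subset)
  show "partitions n \<subseteq> mset ` {xs. set xs \<subseteq> {..n} \<and> length xs \<le> n}"
  proof
    fix \<pi> assume \<pi>: "\<pi> \<in> partitions n"
    obtain xs where xs: "mset xs = \<pi>" using ex_mset by blast
    have "size \<pi> \<le> n"
      using \<pi> size_le_sum_mset by (auto simp: partitions_def)
    moreover have "x \<le> n" if "x \<in># \<pi>" for x
      using \<pi> that by (auto simp: partitions_def sum_mset.remove)
    ultimately have "set xs \<subseteq> {..n} \<and> length xs \<le> n"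
      using xs by auto
    then show "\<pi> \<in> mset ` {xs. set xs \<subseteq> {..n} \<and> length xs \<le> n}"
      using xs by blast
  qed
  show "finite (mset ` {xs. set xs \<subseteq> {..n} \<and> length xs \<le> n})"
    by (intro finite_imageI finite_lists_length_le) simp
qed

lemma mex_exists:
  fixes A a :: nat
  assumes "A > 0"
  shows "\<exists>x. x \<in> {a + k * A |k. True} \<and> x \<notin># \<pi>"
proof (rule ccontr)
  assume "\<not> ?thesis"
  then have "range (\<lambda>k. a + k * A) \<subseteq> set_mset \<pi>" by auto
  then have "finite (range (\<lambda>k. a + k * A))"
    using finite_subset by blast
  moreover have "inj (\<lambda>k. a + k * A)"
    using assms by (auto simp: inj_def)
  ultimately show False
    using finite_imageD by blast
qed

lemma num_partitions_differences_summable: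
  fixes f g :: "nat \<Rightarrow> nat"
  assumes "\<And>m. m \<ge> 1 \<Longrightarrow> f m \<ge> m" "\<And>m. m \<ge> 1 \<Longrightarrow> g m \<ge> m"
  shows "(\<lambda>m. num_partitions (int n - int (f m)) - num_partitions (int n - int (g m)))
           summable_on {1..}"
proof (rule finite_nonzero_values_imp_summable_on, rule finite_subset)
  show "{m \<in> {1..}. num_partitions (int n - int (f m))
          - num_partitions (int n - int (g m)) \<noteq> 0} \<subseteq> {..n}"
  proof
    fix m assume m: "m \<in> {m \<in> {1..}. num_partitions (int n - int (f m))
          - num_partitions (int n - int (g m)) \<noteq> 0}"
    show "m \<in> {..n}"
    proof (rule ccontr)
      assume "m \<notin> {..n}"
      then have "f m > n" "g m > n" using assms[of m] m by auto
      then show False using m by (simp add: num_partitions_def)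
    qed
  qed
qed simp

lemma mex_sum_summable:
  fixes A a n :: nat
  assumes "a > 0"
  shows "(\<lambda>m. num_partitions (int n - int (A * (2 * m choose 2) + 2 * a * m))
            - num_partitions (int n - int (A * (2 * m - 1 choose 2) + a * (2 * m - 1))))
           summable_on {1..}"
proof (rule num_partitions_differences_summable)
  fix m :: nat assume "m \<ge> 1"
  have "1 * m \<le> (2 * a) * m" "1 * (2 * m - 1) \<le> a * (2 * m - 1)"
    using assms by (intro mult_right_mono; simp)+
  then show "A * (2 * m choose 2) + 2 * a * m \<ge> m"
       and "A * (2 * m - 1 choose 2) + a * (2 * m - 1) \<ge> m"
    using \<open>m \<ge> 1\<close> by linarith+
qed

end

theory Submission
  imports Defs
begin

text \<open>
  Let \<open>j(\<pi>)\<close> be the index for which the mex is \<open>a + j(\<pi>) A\<close>; the mex is congruent to \<open>a\<close> modulo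
  \<open>2 A\<close> iff \<open>j(\<pi>)\<close> is even. A partition has \<open>j(\<pi>) \<ge> i\<close> iff it contains \<open>a, a + A, \<dots>, a + (i - 1) A\<close>,
  and removing one copy of each of these parts shows that there are
  \<open>p(n - (A (i choose 2) + a i))\<close> such partitions. The \<open>m\<close>-th summand is therefore minus the number
  of partitions with \<open>j(\<pi>) = 2 m - 1\<close>, so the series subtracts the partitions with odd \<open>j(\<pi>)\<close>.
\<close>

definition mex_index :: "nat \<Rightarrow> nat \<Rightarrow> nat multiset \<Rightarrow> nat" where
  "mex_index A a \<pi> = (LEAST k. a + k * A \<notin># \<pi>)"

text \<open>A multiset, so that \<open>\<subseteq>#\<close> tests for the terms and \<open>-\<close>
  removes one copy of each, leaving any further copies in place.\<close>

definition progression :: "nat \<Rightarrow> nat \<Rightarrow> nat \<Rightarrow> nat multiset" where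
  "progression A a i = image_mset (\<lambda>k. a + k * A) (mset_set {..<i})"

lemma mex_index_notin:
  assumes "A > 0"
  shows "a + mex_index A a \<pi> * A \<notin># \<pi>"
proof -
  obtain k where "a + k * A \<notin># \<pi>"
    using mex_exists[OF assms, of a \<pi>] by auto
  then show ?thesis
    unfolding mex_index_def by (rule LeastI)
qed

lemma le_mex_index_iff:
  assumes "A > 0"
  shows "i \<le> mex_index A a \<pi> \<longleftrightarrow> (\<forall>k<i. a + k * A \<in># \<pi>)"
proof
  show "\<forall>k<i. a + k * A \<in># \<pi>" if "i \<le> mex_index A a \<pi>"
    using that not_less_Least[of _ "\<lambda>k. a + k * A \<notin># \<pi>"]
    unfolding mex_index_def by (meson order_less_le_trans)
  show "i \<le> mex_index A a \<pi>" if "\<forall>k<i. a + k * A \<in># \<pi>"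
    using that mex_index_notin[OF assms] not_le_imp_less by blast
qed

lemma mex_eq:
  assumes "A > 0"
  shows "mex A a \<pi> = a + mex_index A a \<pi> * A"
  unfolding mex_def
proof (rule Least_equality)
  show "a + mex_index A a \<pi> * A \<in> {a + k * A |k. True} \<and> a + mex_index A a \<pi> * A \<notin># \<pi>"
    using mex_index_notin[OF assms] by auto
  show "a + mex_index A a \<pi> * A \<le> y" if "y \<in> {a + k * A |k. True} \<and> y \<notin># \<pi>" for y
    using that by (auto simp: mex_index_def intro: Least_le)
qed

text \<open>The difference \<open>mex A a \<pi> - a\<close> is the index times \<open>A\<close>;
  cancelling the positive factor \<open>A\<close>, it is divisible by \<open>2 * A\<close> exactly
  when the index is even.\<close>

lemma mex_cong_iff_even_mex_index:
  assumes "A > 0"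
  shows "[mex A a \<pi> = a] (mod 2 * A) \<longleftrightarrow> even (mex_index A a \<pi>)"
  using assms by (simp add: mex_eq cong_altdef_nat)

lemma count_progression:
  assumes "A > 0"
  shows "count (progression A a i) x = (if \<exists>k<i. x = a + k * A then 1 else 0)"
proof -
  have "inj_on (\<lambda>k. a + k * A) {..<i}"
    using assms by (auto simp: inj_on_def)
  then have "progression A a i = mset_set ((\<lambda>k. a + k * A) ` {..<i})"
    unfolding progression_def by (rule image_mset_mset_set)
  then show ?thesis
    by (auto simp: count_mset_set')
qed

text \<open>No multiplicity in \<open>progression A a i\<close> exceeds 1, so multiset inclusion
  reduces to the membership condition of \<open>le_mex_index_iff\<close>.\<close>

lemma progression_subseteq_iff:
  assumes "A > 0"
  shows "progression A a i \<subseteq># \<pi> \<longleftrightarrow> i \<le> mex_index A a \<pi>"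
  using assms
  by (auto simp: le_mex_index_iff subseteq_mset_def count_progression Suc_le_eq)

lemma sum_mset_progression: "sum_mset (progression A a i) = A * (i choose 2) + a * i"
  unfolding progression_def
  by (induction i) (simp_all add: lessThan_Suc numeral_2_eq_2 algebra_simps)

text \<open>Subtracting \<sigma> and adding it back are mutually inverse; positivity of the elements
  of \<sigma> ensures that adding it yields a partition. If \<sigma> sums to more than
  \<open>n\<close>, both sides are 0.\<close>

lemma card_partitions_containing:
  assumes "\<forall>x \<in># \<sigma>. x > 0"
  shows "int (card {\<pi> \<in> partitions n. \<sigma> \<subseteq># \<pi>}) = num_partitions (int n - int (sum_mset \<sigma>))"
proof (cases "sum_mset \<sigma> \<le> n")
  case True
  have "bij_betw (\<lambda>\<pi>. \<pi> - \<sigma>) {\<pi> \<in> partitions n. \<sigma> \<subseteq># \<pi>} (partitions (n - sum_mset \<sigma>))"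
    using assms True
    by (intro bij_betw_byWitness[where f' = "\<lambda>\<pi>. \<pi> + \<sigma>"])
      (auto simp: partitions_def sum_mset_diff dest: in_diffD)
  then show ?thesis
    using True bij_betw_same_card unfolding num_partitions_def
    by (auto simp flip: of_nat_diff simp del: of_nat_sum_mset)
next
  case False
  have none: "{\<pi> \<in> partitions n. \<sigma> \<subseteq># \<pi>} = {}"
    using False by (auto simp: partitions_def subset_mset.le_iff_add)
  show ?thesis
    unfolding none using False by (simp add: num_partitions_def del: of_nat_sum_mset)
qed

lemma card_le_mex_index:
  assumes "A > 0" and "a > 0"
  shows "int (card {\<pi> \<in> partitions n. i \<le> mex_index A a \<pi>}) =
    num_partitions (int n - int (A * (i choose 2) + a * i))"
proof -
  have "\<forall>x \<in># progression A a i. x > 0"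
    using assms by (auto simp: progression_def)
  from card_partitions_containing[OF this] show ?thesis
    unfolding progression_subseteq_iff[OF assms(1)] sum_mset_progression .
qed

text \<open>This bound truncates the series to a finite sum: \<pi> contains as many terms of the
  progression as its index says, each at least \<open>a \<ge> 1\<close>.\<close>

lemma mex_index_le:
  assumes "A > 0" and "a > 0" and "\<pi> \<in> partitions n"
  shows "mex_index A a \<pi> \<le> n"
proof -
  let ?i = "mex_index A a \<pi>"
  have "?i \<le> a * ?i"
    using assms by simp
  also have "\<dots> \<le> sum_mset (progression A a ?i)"
    by (simp add: sum_mset_progression)
  also have "\<dots> \<le> sum_mset \<pi>"
    using progression_subseteq_iff[OF assms(1), of a ?i \<pi>]
    by (metis order_refl subset_mset.le_iff_add sum_mset.union le_add1)
  finally show ?thesis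
    using assms by (simp add: partitions_def)
qed

theorem theorem3p2:
  fixes A a n :: nat
  assumes "A > 0" and "a > 0"
  shows "int (num_mex_partitions A a n) =
    num_partitions (int n) +
    (\<Sum>\<^sub>\<infinity>m\<in>{1..}.
       num_partitions (int n - int (A * (2 * m choose 2) + 2 * a * m))
     - num_partitions (int n - int (A * (2 * m - 1 choose 2) + a * (2 * m - 1))))"
proof -
  let ?P = "partitions n" and ?j = "mex_index A a"
  let ?E = "\<lambda>m. {\<pi> \<in> ?P. ?j \<pi> = 2 * m - 1}"
  let ?t = "\<lambda>m. num_partitions (int n - int (A * (2 * m choose 2) + 2 * a * m))
     - num_partitions (int n - int (A * (2 * m - 1 choose 2) + a * (2 * m - 1)))"
  note fin = finite_partitions[of n]
  have summand: "?t m = - int (card (?E m))" if "m \<in> {1..}" for m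
  proof -
    \<comment> \<open>As \<open>m \<ge> 1\<close>, the subtraction in \<open>2 * m - 1\<close> does
      not truncate, so the two thresholds differ by exactly one.\<close>
    have "{\<pi> \<in> ?P. 2 * m - 1 \<le> ?j \<pi>} = {\<pi> \<in> ?P. 2 * m \<le> ?j \<pi>} \<union> ?E m"
      using that by auto
    moreover have "{\<pi> \<in> ?P. 2 * m \<le> ?j \<pi>} \<inter> ?E m = {}"
      using that by auto
    ultimately have "card {\<pi> \<in> ?P. 2 * m - 1 \<le> ?j \<pi>} = card {\<pi> \<in> ?P. 2 * m \<le> ?j \<pi>} + card (?E m)"
      using fin by (simp add: card_Un_disjoint)
    then show ?thesis
      using card_le_mex_index[OF assms, of n "2 * m"] card_le_mex_index[OF assms, of n "2 * m - 1"]
      by (simp add: mult.left_commute mult.assoc)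
  qed
  have "infsum ?t {1..} = (\<Sum>\<^sub>\<infinity>m\<in>{1..}. - int (card (?E m)))"
    using summand by (rule infsum_cong)
  \<comment> \<open>For \<open>m > n\<close> the index \<open>2 * m - 1\<close> would exceed
    \<open>n\<close>.\<close>
  also have "\<dots> = (\<Sum>\<^sub>\<infinity>m\<in>{1..n}. - int (card (?E m)))"
  proof (rule infsum_cong_neutral)
    fix m assume "m \<in> {1..} - {1..n}"
    then have "?E m = {}"
      using mex_index_le[OF assms, of _ n] by fastforce
    then show "- int (card (?E m)) = 0"
      by (metis card.empty of_nat_0 minus_zero)
  qed auto
  also have "\<dots> = - int (\<Sum>m\<in>{1..n}. card (?E m))"
    by (simp add: sum_negf)
  also have "(\<Sum>m\<in>{1..n}. card (?E m)) = card (\<Union>m\<in>{1..n}. ?E m)"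
    using fin by (intro card_UN_disjoint[symmetric]) auto
  also have "(\<Union>m\<in>{1..n}. ?E m) = {\<pi> \<in> ?P. odd (?j \<pi>)}"
  proof (intro equalityI subsetI)
    fix \<pi> assume "\<pi> \<in> {\<pi> \<in> ?P. odd (?j \<pi>)}"
    moreover from this obtain k where "?j \<pi> = 2 * k + 1"
      by (auto elim: oddE)
    \<comment> \<open>Here \<open>2 * k + 1 = 2 * (k + 1) - 1\<close>, and
      \<open>k + 1 \<le> 2 * k + 1 \<le> n\<close>.\<close>
    ultimately have "\<pi> \<in> ?E (k + 1)" "k + 1 \<in> {1..n}"
      using mex_index_le[OF assms, of \<pi> n] by auto
    then show "\<pi> \<in> (\<Union>m\<in>{1..n}. ?E m)"
      by blast
  qed auto
  finally have series: "infsum ?t {1..} = - int (card {\<pi> \<in> ?P. odd (?j \<pi>)})" .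
  have "?P = {\<pi> \<in> ?P. even (?j \<pi>)} \<union> {\<pi> \<in> ?P. odd (?j \<pi>)}"
    by auto
  also have "card \<dots> = card {\<pi> \<in> ?P. even (?j \<pi>)} + card {\<pi> \<in> ?P. odd (?j \<pi>)}"
    using fin by (intro card_Un_disjoint) auto
  finally show ?thesis
    unfolding series
    by (simp add: num_mex_partitions_def num_partitions_def mex_cong_iff_even_mex_index assms)
qed

end
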